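(* The diameters of the curves $\Gamma_n$ grow at least on the order of $n\log\log n$; that is, there exists a constant $c>0$ such that for all sufficiently large $n$, \[ \operatorname{diam}\big(\Gamma_n([-\pi,\pi])\big)\ge c\,n\log\log n . \]
   Context: For $n\in\mathbb{N}$ and a prime $p$, $v_p(n!)$ denotes the exponent of $p$ in the prime factorization of $n!$. For each $n\in\mathbb{N}$ define $F_n(t)=\sum_{p\le n} v_p(n!)\,e^{ipt}$ for $t\in[-\pi,\pi]$, where the sum runs over primes $p\le n$. The associated planar curve is $\Gamma_n(t)=(\operatorname{Re}F_n(t),\operatorname{Im}F_n(t))\in\mathbb{R}^2$, $t\in[-\pi,\pi]$. The diameter is taken with respect to the Euclidean distance in $\mathbb{R}^2$. *)

theory Defs
  imports "HOL-Analysis.Analysis" "HOL-Computational_Algebra.Primes"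
begin

definition F :: "nat \<Rightarrow> real \<Rightarrow> complex" where
  "F n t = (\<Sum>p | prime p \<and> p \<le> n.
     of_nat (multiplicity p (fact n :: nat)) * exp (\<i> * of_nat p * of_real t))"

(* The metric of the product type real \<times> real is the Euclidean one (dist_prod_def). *)
definition \<Gamma> :: "nat \<Rightarrow> real \<Rightarrow> real \<times> real" where
  "\<Gamma> n t = (Re (F n t), Im (F n t))"

end

theory Submission
  imports Defs "HOL-Real_Asymp.Real_Asymp"
begin

text \<open>The points at \<open>t = 0\<close> and \<open>t = pi\<close> suffice: odd primes contribute with opposite signs there,
  so the real parts differ by twice the sum of \<open>v_p(n!) \<ge> n div p \<ge> n / (2p)\<close> over the odd primes
  \<open>p \<le> n\<close>. Since \<open>1 + 1/(p - 1) \<le> exp (2/p)\<close>, Euler's product argument yields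
  \<open>ln n \<le> exp (2 \<cdot> \<Sum>1/p)\<close>, a sufficiently strong form of Mertens' theorem.\<close>

text \<open>The cutoff \<open>N\<close> keeps every sum finite, so the Euler product bound needs no
  infinite series.\<close>

definition smooth_upto :: "nat set \<Rightarrow> nat \<Rightarrow> nat set" where
  "smooth_upto S N = {m \<in> {1..N}. \<forall>p. prime p \<and> p dvd m \<longrightarrow> p \<in> S}"

lemma finite_smooth_upto [simp]: "finite (smooth_upto S N)"
  by (simp add: smooth_upto_def)

lemma smooth_upto_empty: "smooth_upto {} N \<subseteq> {1}"
  by (auto simp: smooth_upto_def) (metis One_nat_def prime_factor_nat)

text \<open>Only one factor \<open>p\<close> is divided out, and the quotient may still be divisible
  by \<open>p\<close>. Hence the same set recurs on the right; this self-reference replaces the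
  geometric series in 1/p.\<close>

lemma smooth_upto_insert:
  assumes "prime p"
  shows "smooth_upto (insert p S) N \<subseteq> smooth_upto S N \<union> (*) p ` smooth_upto (insert p S) N"
proof
  fix m assume m: "m \<in> smooth_upto (insert p S) N"
  show "m \<in> smooth_upto S N \<union> (*) p ` smooth_upto (insert p S) N"
  proof (cases "p dvd m")
    case True
    then obtain k where k: "m = p * k" by blast
    have "k \<le> m" using k prime_gt_0_nat[OF assms] by simp
    then have "k \<le> N" using m by (simp add: smooth_upto_def)
    then have "k \<in> smooth_upto (insert p S) N"
      using m k by (auto simp: smooth_upto_def)
    then show ?thesis using k by blast
  next
    case False
    then show ?thesis using m by (auto simp: smooth_upto_def)
  qed
qed

lemma sum_inverse_smooth_le_prod:
  assumes "finite S" "\<And>p. p \<in> S \<Longrightarrow> prime p"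
  shows "(\<Sum>m\<in>smooth_upto S N. 1 / real m) \<le> (\<Prod>p\<in>S. 1 + 1 / (real p - 1))"
  using assms
proof (induction S rule: finite_induct)
  case empty
  have "(\<Sum>m\<in>smooth_upto {} N. 1 / real m) \<le> (\<Sum>m\<in>{1}. 1 / real m)"
    by (intro sum_mono2 smooth_upto_empty) auto
  then show ?case by simp
next
  case (insert p S)
  define A where "A = (\<Sum>m\<in>smooth_upto (insert p S) N. 1 / real m)"
  define B where "B = (\<Sum>m\<in>smooth_upto S N. 1 / real m)"
  have p: "real p > 1" using insert.prems prime_gt_1_nat by simp
  have "A \<le> (\<Sum>m\<in>smooth_upto S N \<union> (*) p ` smooth_upto (insert p S) N. 1 / real m)"
    unfolding A_def using insert.prems by (intro sum_mono2 smooth_upto_insert) auto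
  also have "\<dots> \<le> B + (\<Sum>m\<in>(*) p ` smooth_upto (insert p S) N. 1 / real m)"
    unfolding B_def by (subst sum.union_inter [symmetric]) (auto intro: sum_nonneg)
  also have "(\<Sum>m\<in>(*) p ` smooth_upto (insert p S) N. 1 / real m) = A / real p"
    using p by (subst sum.reindex)
      (auto simp: inj_on_def A_def sum_divide_distrib mult.commute)
  \<comment> \<open>The chain gives A \<le> B + A/p; solving for A yields the factor p/(p - 1) = 1 +
    1/(p - 1).\<close>
  finally have "A \<le> B * (1 + 1 / (real p - 1))"
    using p by (simp add: field_simps)
  also have "\<dots> \<le> (\<Prod>p\<in>S. 1 + 1 / (real p - 1)) * (1 + 1 / (real p - 1))"
    using insert p by (intro mult_right_mono) (auto simp: B_def)
  finally show ?case using insert.hyps by (simp add: A_def mult.commute)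
qed

lemma ln_ln_le_sum_inverse_primes:
  assumes "n > 1"
  shows "ln (ln (real n)) \<le> 2 * (\<Sum>p | prime p \<and> p \<le> n. 1 / real p)"
proof -
  let ?P = "{p. prime p \<and> p \<le> n}"
  \<comment> \<open>A prime divisor of m \<le> n is itself at most n, so the sum over smooth numbers
    is the full harmonic sum.\<close>
  have smooth: "smooth_upto ?P n = {1..n}"
    by (auto simp: smooth_upto_def dest: dvd_imp_le)
  have "ln (real n) \<le> ln (real n + 1)" using assms by simp
  also have "\<dots> \<le> harm n" by (rule ln_le_harm)
  also have "\<dots> = (\<Sum>m\<in>smooth_upto ?P n. 1 / real m)"
    by (simp add: harm_def smooth inverse_eq_divide)
  also have "\<dots> \<le> (\<Prod>p\<in>?P. 1 + 1 / (real p - 1))"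
    by (rule sum_inverse_smooth_le_prod) auto
  also have "\<dots> \<le> (\<Prod>p\<in>?P. exp (2 / real p))"
  proof (rule prod_mono)
    fix p assume "p \<in> ?P"
    then have p: "real p \<ge> 2" using prime_ge_2_nat by auto
    then have "1 / (real p - 1) \<le> 2 / real p" by (simp add: field_simps)
    then have "1 + 1 / (real p - 1) \<le> exp (2 / real p)"
      using exp_ge_add_one_self[of "2 / real p"] by linarith
    then show "0 \<le> 1 + 1 / (real p - 1) \<and> 1 + 1 / (real p - 1) \<le> exp (2 / real p)"
      using p by simp
  qed
  also have "\<dots> = exp (2 * (\<Sum>p\<in>?P. 1 / real p))"
    by (simp add: exp_sum sum_distrib_left)
  finally have "ln (ln (real n)) \<le> ln (exp (2 * (\<Sum>p\<in>?P. 1 / real p)))"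
    using assms by (subst ln_le_cancel_iff) auto
  then show ?thesis by simp
qed

lemma prime_power_dvd_fact_mult:
  fixes p k :: nat
  assumes "p > 0"
  shows "p ^ k dvd fact (p * k)"
proof (induction k)
  case (Suc k)
  \<comment> \<open>Peel off the top factor \<open>p * Suc k\<close> of the factorial: it supplies
    one more \<open>p\<close>, and \<open>p * k \<le> m\<close> leaves \<open>p ^ k\<close> dividing
    \<open>fact m\<close>.\<close>
  obtain m where m: "p * Suc k = Suc m" using assms by (cases "p * Suc k") auto
  have "p * k \<le> m" using m assms by simp
  then have "p ^ k dvd (fact m :: nat)" using Suc fact_dvd dvd_trans by blast
  moreover have "p dvd Suc m" using m by (metis dvd_triv_left)
  ultimately have "p ^ Suc k dvd Suc m * fact m" by (simp only: power_Suc mult_dvd_mono)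
  then show ?case unfolding m by simp
qed simp

text \<open>This keeps just the first term of Legendre's formula, the count of multiples of
  \<open>p\<close> up to \<open>n\<close>.\<close>

lemma div_le_multiplicity_fact:
  fixes p n :: nat
  assumes "prime p"
  shows "n div p \<le> multiplicity p (fact n :: nat)"
proof (rule multiplicity_geI)
  have "p ^ (n div p) dvd (fact (p * (n div p)) :: nat)"
    using assms by (intro prime_power_dvd_fact_mult prime_gt_0_nat)
  also have "(fact (p * (n div p)) :: nat) dvd fact n" by (intro fact_dvd) simp
  finally show "p ^ (n div p) dvd (fact n :: nat)" .
qed (use assms in auto)

text \<open>The remainder is below \<open>p\<close>, and \<open>p\<close> is at most
  \<open>p * (n div p)\<close> because the quotient is at least 1.\<close>

lemma half_quotient_le_div:
  fixes p n :: nat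
  assumes "0 < p" "p \<le> n"
  shows "real n / (2 * real p) \<le> real (n div p)"
proof -
  have "n div p \<ge> 1" using assms by (simp add: Suc_le_eq div_greater_zero_iff)
  then have "p * 1 \<le> p * (n div p)" by (intro mult_left_mono) auto
  moreover have "n = p * (n div p) + n mod p" by simp
  moreover have "n mod p < p" using assms by simp
  ultimately have "n \<le> 2 * (p * (n div p))" by linarith
  then have "real n \<le> real (2 * (p * (n div p)))" by (simp only: of_nat_le_iff)
  then show ?thesis using assms by (simp add: field_simps)
qed

lemma Re_F: "Re (F n t) =
    (\<Sum>p | prime p \<and> p \<le> n. real (multiplicity p (fact n :: nat)) * cos (real p * t))"
  by (simp add: F_def Re_exp)

text \<open>An odd prime contributes 2 v_p(n!), whose factor 2 makes up for the halving in
  \<open>half_quotient_le_div\<close>. The prime 2 cancels, since cos (2 pi) = 1; the 1/2 removes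
  its reciprocal from the sum.\<close>

lemma Re_F_diff_ge:
  "real n * ((\<Sum>p | prime p \<and> p \<le> n. 1 / real p) - 1 / 2) \<le> Re (F n 0) - Re (F n pi)"
proof -
  let ?P = "{p. prime p \<and> p \<le> n}"
  let ?v = "\<lambda>p. real (multiplicity p (fact n :: nat))"
  \<comment> \<open>Not an equality in general: for n < 2 the prime 2 is absent from
    \<open>?P\<close> and the last sum is 0.\<close>
  have "real n * (\<Sum>p\<in>?P. 1 / real p) - real n / 2
      \<le> (\<Sum>p\<in>?P. real n / real p) - (\<Sum>p\<in>?P. if p = 2 then real n / 2 else 0)"
    by (simp add: sum_distrib_left sum.delta)
  also have "\<dots> = (\<Sum>p\<in>?P. real n / real p - (if p = 2 then real n / 2 else 0))"
    by (simp add: sum_subtractf)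
  also have "\<dots> \<le> (\<Sum>p\<in>?P. ?v p - ?v p * cos (real p * pi))"
  proof (rule sum_mono)
    fix p assume p: "p \<in> ?P"
    show "real n / real p - (if p = 2 then real n / 2 else 0) \<le> ?v p - ?v p * cos (real p * pi)"
    proof (cases "p = 2")
      case True
      then show ?thesis using cos_npi[of 2] by simp
    next
      case False
      then have "odd p" using p prime_odd_nat[of p] prime_ge_2_nat[of p] by auto
      then have c: "cos (real p * pi) = -1" by (simp add: cos_npi)
      have "real n / (2 * real p) \<le> real (n div p)"
        using p prime_gt_0_nat by (intro half_quotient_le_div) auto
      also have "\<dots> \<le> ?v p" using p div_le_multiplicity_fact by simp
      finally show ?thesis using False c by simp
    qed
  qed
  also have "\<dots> = Re (F n 0) - Re (F n pi)"
    by (simp add: Re_F sum_subtractf)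
  finally show ?thesis by (simp add: right_diff_distrib)
qed

text \<open>\<open>diameter\<close> is a real-valued supremum; boundedness ensures that it dominates
  the distances between points of the curve.\<close>

lemma bounded_curve: "bounded (\<Gamma> n ` {-pi..pi})"
proof -
  have "continuous_on {-pi..pi} (\<Gamma> n)"
    unfolding \<Gamma>_def F_def by (intro continuous_intros)
  then show ?thesis
    by (intro compact_imp_bounded compact_continuous_image) auto
qed

lemma Re_F_diff_le_diameter: "Re (F n 0) - Re (F n pi) \<le> diameter (\<Gamma> n ` {-pi..pi})"
proof -
  have "Re (F n 0) - Re (F n pi) \<le> dist (fst (\<Gamma> n 0)) (fst (\<Gamma> n pi))"
    by (simp add: \<Gamma>_def dist_real_def)
  also have "\<dots> \<le> dist (\<Gamma> n 0) (\<Gamma> n pi)" by (rule dist_fst_le)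
  also have "\<dots> \<le> diameter (\<Gamma> n ` {-pi..pi})"
    by (intro diameter_bounded_bound bounded_curve imageI) auto
  finally show ?thesis .
qed

theorem mainTheorem5:
  shows "\<exists>c::real. c > 0 \<and>
    (\<forall>\<^sub>F n in sequentially.
       diameter (\<Gamma> n ` {-pi..pi}) \<ge> c * real n * ln (ln (real n)))"
proof (intro exI conjI)
  \<comment> \<open>With L = ln (ln n), the prime sum minus 1/2 is at least L/2 - 1/2, and this is
    at least L/4 exactly when L \<ge> 2.\<close>
  have "\<forall>\<^sub>F n in sequentially. ln (ln (real n)) \<ge> 2" by real_asymp
  then show "\<forall>\<^sub>F n in sequentially.
      diameter (\<Gamma> n ` {-pi..pi}) \<ge> (1 / 4) * real n * ln (ln (real n))"
    using eventually_gt_at_top[of 1]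
  proof eventually_elim
    case (elim n)
    have "1 / 4 * ln (ln (real n)) \<le> (\<Sum>p | prime p \<and> p \<le> n. 1 / real p) - 1 / 2"
      using ln_ln_le_sum_inverse_primes[of n] elim by linarith
    then have "real n * (1 / 4 * ln (ln (real n)))
        \<le> real n * ((\<Sum>p | prime p \<and> p \<le> n. 1 / real p) - 1 / 2)"
      by (intro mult_left_mono) auto
    also have "\<dots> \<le> diameter (\<Gamma> n ` {-pi..pi})"
      using Re_F_diff_ge Re_F_diff_le_diameter by (rule order_trans)
    finally show ?case by (simp add: mult_ac)
  qed
qed simp

end
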